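(* If $G$ is a split graph or a cograph with a perfect matching, then $f(G)\geq \frac{\delta(G)-1}{2}$. Moreover, the bound is tight: there exist split graphs and cographs with a perfect matching (of every even order $2n$ and every minimum degree $2k+1$, $0\le k\le n-1$) attaining $f(G)=\frac{\delta(G)-1}{2}$.
   Context: All graphs are finite and simple. For a graph $G$ with a perfect matching $M$, a subset $S\subseteq M$ is a forcing set of $M$ if $S$ is contained in no perfect matching of $G$ other than $M$. $f(G,M)$ is the minimum size of a forcing set of $M$, and $f(G)=\min_M f(G,M)$ over all perfect matchings $M$. $\delta(G)$ is the minimum degree. A graph is split if its vertex set can be partitioned into a clique and an independent set. A cograph is a graph that is either a single vertex or is obtained as the disjoint union or the join of two cographs, where the join of $G$ and $H$ is their disjoint union together with all edges between $V(G)$ and $V(H)$. *)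

theory Defs
  imports Complex_Main "HOL-Library.Ramsey"
begin

text \<open>
  A graph is given by its vertex set \<open>V\<close> and its set \<open>E\<close> of two-element edges.  The vertex
  set is nonempty, since the minimum degree is not defined for the null graph.
\<close>

definition simple_graph :: "'a set \<Rightarrow> 'a set set \<Rightarrow> bool" where
  "simple_graph V E \<longleftrightarrow> finite V \<and> V \<noteq> {} \<and> E \<subseteq> [V]\<^bsup>2\<^esup>"

definition degree :: "'a set set \<Rightarrow> 'a \<Rightarrow> nat" where
  "degree E v = card {e \<in> E. v \<in> e}"

definition min_degree :: "'a set \<Rightarrow> 'a set set \<Rightarrow> nat" where
  "min_degree V E = Min (degree E ` V)"

definition perfect_matching :: "'a set \<Rightarrow> 'a set set \<Rightarrow> 'a set set \<Rightarrow> bool" where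
  "perfect_matching V E M \<longleftrightarrow> M \<subseteq> E \<and> (\<forall>v\<in>V. \<exists>!e. e \<in> M \<and> v \<in> e)"

definition has_perfect_matching :: "'a set \<Rightarrow> 'a set set \<Rightarrow> bool" where
  "has_perfect_matching V E \<longleftrightarrow> (\<exists>M. perfect_matching V E M)"

definition forcing_set :: "'a set \<Rightarrow> 'a set set \<Rightarrow> 'a set set \<Rightarrow> 'a set set \<Rightarrow> bool" where
  "forcing_set V E M S \<longleftrightarrow>
     S \<subseteq> M \<and> (\<forall>M'. perfect_matching V E M' \<and> S \<subseteq> M' \<longrightarrow> M' = M)"

definition matching_forcing_number :: "'a set \<Rightarrow> 'a set set \<Rightarrow> 'a set set \<Rightarrow> nat" where
  "matching_forcing_number V E M = Min {card S | S. forcing_set V E M S}"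

text \<open>Only meaningful for finite graphs that have a perfect matching.\<close>

definition forcing_number :: "'a set \<Rightarrow> 'a set set \<Rightarrow> nat" where
  "forcing_number V E = Min {matching_forcing_number V E M | M. perfect_matching V E M}"

text \<open>Either of the two parts may be empty.\<close>

definition split_graph :: "'a set \<Rightarrow> 'a set set \<Rightarrow> bool" where
  "split_graph V E \<longleftrightarrow>
     (\<exists>K I. K \<union> I = V \<and> K \<inter> I = {} \<and> clique K E \<and> indep I E)"

inductive cograph :: "'a set \<Rightarrow> 'a set set \<Rightarrow> bool" where
  single: "cograph {v} {}"
| disjoint_union:
    "\<lbrakk>cograph V E; cograph W F; V \<inter> W = {}\<rbrakk> \<Longrightarrow> cograph (V \<union> W) (E \<union> F)"
| join:
    "\<lbrakk>cograph V E; cograph W F; V \<inter> W = {}\<rbrakk>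
     \<Longrightarrow> cograph (V \<union> W) (E \<union> F \<union> {{v, w} | v w. v \<in> V \<and> w \<in> W})"

end

theory Submission
  imports Defs
begin

text \<open>
  If \<open>S\<close> forces \<open>M\<close>, then \<open>M - S\<close> is the only perfect matching of the subgraph induced by the
  vertices that \<open>S\<close> leaves uncovered.  A split graph or cograph with a unique perfect matching has
  a vertex of degree one, since otherwise some alternating cycle could be switched.  In the whole
  graph this vertex has at most \<open>2 * card S\<close> further neighbours, so the minimum degree is at most
  \<open>1 + 2 * card S\<close>.

  Equality holds for the threshold graph on \<open>0, \<dots>, 2 * n - 1\<close> in which \<open>b\<close> is adjacent to all
  smaller vertices iff \<open>b\<close> is odd or \<open>b \<ge> 2 * (n - k)\<close>: this graph is both split and a cograph, and
  once the top \<open>k\<close> pairs \<open>{2 * j, 2 * j + 1}\<close> are fixed, all other pairs follow from the top down.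
\<close>

section \<open>Neighbours and perfect matchings\<close>

definition neighbours :: "'a set set \<Rightarrow> 'a \<Rightarrow> 'a set" where
  "neighbours E v = {w. {v, w} \<in> E}"

lemma doubleton_nsets_iff: "{v, w} \<in> [V]\<^bsup>2\<^esup> \<longleftrightarrow> v \<in> V \<and> w \<in> V \<and> v \<noteq> w"
  by (cases "v = w") (auto simp: nsets_def)

lemma edgeD:
  assumes "E \<subseteq> [V]\<^bsup>2\<^esup>" "{v, w} \<in> E"
  shows "v \<in> V" "w \<in> V" "v \<noteq> w"
  using subsetD[OF assms] unfolding doubleton_nsets_iff by blast+

lemma nsets_2_memE:
  assumes "e \<in> [V]\<^bsup>2\<^esup>" "v \<in> e"
  obtains w where "e = {v, w}" "v \<in> V" "w \<in> V" "v \<noteq> w"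
  using assms by (auto simp: nsets_def card_2_iff)

lemma Union_nsets_subset: "E \<subseteq> [V]\<^bsup>k\<^esup> \<Longrightarrow> \<Union>E \<subseteq> V"
  by (auto simp: nsets_def)

lemma degree_eq_card_neighbours:
  assumes "E \<subseteq> [V]\<^bsup>2\<^esup>"
  shows "degree E v = card (neighbours E v)"
proof -
  have "{e \<in> E. v \<in> e} = (\<lambda>w. {v, w}) ` neighbours E v"
    using assms by (fastforce simp: neighbours_def elim!: nsets_2_memE)
  moreover have "inj_on (\<lambda>w. {v, w}) (neighbours E v)"
    by (auto simp: inj_on_def doubleton_eq_iff)
  ultimately show ?thesis
    by (simp add: degree_def card_image)
qed

section \<open>Vertex-disjoint edge families and perfect matchings\<close>

lemma pairwise_disjnt_Un:
  assumes "pairwise disjnt A" "pairwise disjnt B" "\<Union>A \<inter> \<Union>B = {}"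
  shows "pairwise disjnt (A \<union> B)"
proof -
  have "disjnt a b" "disjnt b a" if "a \<in> A" "b \<in> B" for a b
    using assms(3) that unfolding disjnt_def by blast+
  then show ?thesis
    using assms(1,2) unfolding pairwise_def by blast
qed

lemma Union_Diff_Int_Union:
  assumes "pairwise disjnt N" "A \<subseteq> N"
  shows "\<Union>(N - A) \<inter> \<Union>A = {}"
proof -
  have "e \<inter> e' = {}" if "e \<in> N - A" "e' \<in> A" for e e'
    using pairwiseD[OF assms(1), of e e'] assms(2) that by (auto simp: disjnt_def)
  then show ?thesis
    by blast
qed

lemma perfect_matching_edge_eq:
  assumes "perfect_matching V E M" "v \<in> V" "e \<in> M" "e' \<in> M" "v \<in> e" "v \<in> e'"
  shows "e = e'"
  using assms unfolding perfect_matching_def by blast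

lemma perfect_matching_disjnt:
  assumes "E \<subseteq> [V]\<^bsup>2\<^esup>" "perfect_matching V E M"
  shows "pairwise disjnt M"
proof (rule pairwiseI)
  fix e e' assume *: "e \<in> M" "e' \<in> M" "e \<noteq> e'"
  then have "v \<in> V" if "v \<in> e" for v
    using that assms Union_nsets_subset[OF assms(1)] by (auto simp: perfect_matching_def)
  then show "disjnt e e'"
    using perfect_matching_edge_eq[OF assms(2) _ *(1,2)] *(3) unfolding disjnt_def by blast
qed

lemma perfect_matching_Union:
  assumes "E \<subseteq> [V]\<^bsup>2\<^esup>" "perfect_matching V E M"
  shows "\<Union>M = V"
proof
  show "\<Union>M \<subseteq> V"
    using assms by (auto simp: perfect_matching_def nsets_def)
  show "V \<subseteq> \<Union>M"
    using assms(2) unfolding perfect_matching_def by blast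
qed

lemma perfect_matchingI:
  assumes "M \<subseteq> E" "pairwise disjnt M" "V \<subseteq> \<Union>M"
  shows "perfect_matching V E M"
  unfolding perfect_matching_def
proof (intro conjI ballI ex_ex1I)
  show "M \<subseteq> E"
    by fact
next
  fix v assume "v \<in> V"
  then show "\<exists>e. e \<in> M \<and> v \<in> e"
    using assms(3) by blast
next
  fix v e e' assume "e \<in> M \<and> v \<in> e" "e' \<in> M \<and> v \<in> e'"
  then show "e = e'"
    using pairwiseD[OF assms(2), of e e'] unfolding disjnt_def by blast
qed

text \<open>Each edge of \<open>M'\<close> has an endpoint already covered by an edge of
  \<open>M\<close>, which also lies in \<open>M'\<close>; since \<open>M'\<close> covers that
  endpoint only once, the two edges coincide.\<close>

lemma perfect_matching_subset_eq:
  assumes "E \<subseteq> [V]\<^bsup>2\<^esup>" "perfect_matching V E M" "perfect_matching V E M'" "M \<subseteq> M'"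
  shows "M' = M"
proof
  show "M' \<subseteq> M"
  proof
    fix e assume e: "e \<in> M'"
    then have "e \<in> [V]\<^bsup>2\<^esup>"
      using assms(1,3) by (auto simp: perfect_matching_def)
    then obtain v where v: "v \<in> e" "v \<in> V"
      by (auto simp: nsets_def card_2_iff)
    then obtain e' where "e' \<in> M" "v \<in> e'"
      using assms(2) unfolding perfect_matching_def by blast
    then show "e \<in> M"
      using perfect_matching_edge_eq[OF assms(3) v(2) e _ v(1)] assms(4) by blast
  qed
qed (use assms in blast)

lemma finite_edges: "simple_graph V E \<Longrightarrow> finite E"
  using finite_subset finite_imp_finite_nsets unfolding simple_graph_def by blast

section \<open>Uniquely matched edge sets\<close>

text \<open>This encodes that \<open>N\<close> is the only perfect matching of the subgraph induced
  by \<open>\<Union>N\<close>: competitors may use any edges of \<open>E\<close> but must cover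
  exactly the same vertices.\<close>

definition unique_matching :: "'a set set \<Rightarrow> 'a set set \<Rightarrow> bool" where
  "unique_matching E N \<longleftrightarrow> N \<subseteq> E \<and> pairwise disjnt N \<and>
     (\<forall>N'. N' \<subseteq> E \<and> pairwise disjnt N' \<and> \<Union>N' = \<Union>N \<longrightarrow> N' = N)"

text \<open>The cycle in question is a, b, d, c with \<open>{a, b}\<close> and \<open>{c, d}\<close>
  in \<open>N\<close>. Exchanging the names of c and d covers the other way of closing it. The
  condition passes to subsets of \<open>E\<close> and \<open>N\<close>.\<close>

definition no_alternating_C4 :: "'a set set \<Rightarrow> 'a set set \<Rightarrow> bool" where
  "no_alternating_C4 E N \<longleftrightarrow>
     (\<forall>a b c d. {a, b} \<in> N \<longrightarrow> {c, d} \<in> N \<longrightarrow> {a, b} \<noteq> {c, d} \<longrightarrow> {a, c} \<in> E \<longrightarrow> {b, d} \<notin> E)"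

lemma no_alternating_C4D:
  assumes "no_alternating_C4 E N" "{a, b} \<in> N" "{c, d} \<in> N" "{a, b} \<noteq> {c, d}"
    "{a, c} \<in> E" "{b, d} \<in> E"
  shows False
  using assms unfolding no_alternating_C4_def by blast

text \<open>Exchanging \<open>A\<close> for \<open>B\<close> inside \<open>N\<close> gives a
  matching with the same cover, because the edges of \<open>N - A\<close> avoid the vertices of
  \<open>A\<close>. By uniqueness the exchange changes nothing.\<close>

lemma unique_matching_switch:
  assumes "unique_matching E N" "A \<subseteq> N" "B \<subseteq> E" "pairwise disjnt B" "\<Union>B = \<Union>A"
  shows "B \<subseteq> N"
proof -
  have N: "N \<subseteq> E" "pairwise disjnt N"
    using assms(1) by (auto simp: unique_matching_def)
  let ?N' = "(N - A) \<union> B"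
  have "pairwise disjnt ?N'"
    using pairwise_subset[OF N(2)] assms(4,5) Union_Diff_Int_Union[OF N(2) assms(2)]
    by (intro pairwise_disjnt_Un) auto
  moreover have "\<Union>?N' = \<Union>N"
    using assms(2,5) by blast
  moreover have "?N' \<subseteq> E"
    using N assms(3) by blast
  ultimately have "?N' = N"
    using assms(1) unfolding unique_matching_def by blast
  then show ?thesis
    by blast
qed

lemma unique_matching_no_alternating_C4:
  assumes "unique_matching E N" "N \<subseteq> [V]\<^bsup>2\<^esup>"
  shows "no_alternating_C4 E N"
  unfolding no_alternating_C4_def
proof (intro allI impI notI)
  fix a b c d
  assume *: "{a, b} \<in> N" "{c, d} \<in> N" "{a, b} \<noteq> {c, d}" "{a, c} \<in> E" "{b, d} \<in> E"
  have N: "pairwise disjnt N"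
    using assms(1) by (simp add: unique_matching_def)
  have "disjnt {a, b} {c, d}"
    using pairwiseD[OF N *(1,2,3)] .
  moreover have "a \<noteq> b" "c \<noteq> d"
    using edgeD(3)[OF assms(2)] * by blast+
  ultimately have dist: "a \<noteq> b" "a \<noteq> c" "a \<noteq> d" "b \<noteq> c" "b \<noteq> d" "c \<noteq> d"
    by (auto simp: disjnt_def)
  \<comment> \<open>Switching along the 4-cycle puts \<open>{a, c}\<close> into \<open>N\<close>,
    where it shares only the vertex a with \<open>{a, b}\<close>; this contradicts
    disjointness.\<close>
  have "{{a, c}, {b, d}} \<subseteq> N"
    by (rule unique_matching_switch[OF assms(1), of "{{a, b}, {c, d}}"])
      (use * dist in \<open>auto simp: pairwise_def disjnt_def\<close>)
  then have "disjnt {a, b} {a, c} \<or> {a, b} = {a, c}"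
    using pairwiseD[OF N, of "{a, b}" "{a, c}"] *(1) by blast
  then show False
    using dist by (auto simp: disjnt_def doubleton_eq_iff)
qed

text \<open>A competitor \<open>N'\<close> together with \<open>S\<close> is a perfect matching of
  the whole graph that contains \<open>S\<close>, hence it is \<open>M\<close>.\<close>

lemma forcing_set_unique_matching:
  assumes E: "E \<subseteq> [V]\<^bsup>2\<^esup>" and M: "perfect_matching V E M" and S: "forcing_set V E M S"
  shows "unique_matching E (M - S)"
  unfolding unique_matching_def
proof (intro conjI allI impI)
  have SM: "S \<subseteq> M"
    using S by (simp add: forcing_set_def)
  have dM: "pairwise disjnt M"
    by (rule perfect_matching_disjnt[OF E M])
  show "M - S \<subseteq> E"
    using M by (auto simp: perfect_matching_def)
  show "pairwise disjnt (M - S)"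
    using dM by (rule pairwise_subset) blast
  fix N' assume N': "N' \<subseteq> E \<and> pairwise disjnt N' \<and> \<Union>N' = \<Union>(M - S)"
  have sep: "\<Union>S \<inter> \<Union>N' = {}"
    using N' Union_Diff_Int_Union[OF dM SM] by (simp add: Int_commute)
  have "perfect_matching V E (S \<union> N')"
  proof (rule perfect_matchingI)
    show "S \<union> N' \<subseteq> E"
      using SM M N' by (auto simp: perfect_matching_def)
    show "pairwise disjnt (S \<union> N')"
      using pairwise_subset[OF dM SM] N' sep by (intro pairwise_disjnt_Un) auto
    show "V \<subseteq> \<Union>(S \<union> N')"
      using perfect_matching_Union[OF E M] N' SM by blast
  qed
  then have "S \<union> N' = M"
    using S unfolding forcing_set_def by blast
  \<comment> \<open>The covers of \<open>S\<close> and \<open>N'\<close> are disjoint, so a common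
    edge would be empty, but edges have two elements.\<close>
  moreover have "S \<inter> N' = {}"
  proof (rule ccontr)
    assume "S \<inter> N' \<noteq> {}"
    then obtain e where e: "e \<in> S" "e \<in> N'"
      by blast
    then have "e = {}"
      using sep by blast
    moreover have "e \<in> [V]\<^bsup>2\<^esup>"
      using e N' E by blast
    ultimately show False
      by (simp add: nsets_def)
  qed
  ultimately show "N' = M - S"
    by blast
qed

section \<open>Split graphs\<close>

text \<open>A minimal nonempty invariant subset equals its own image, and a surjection of a finite
  set onto itself is injective. This finds a union of cycles of \<open>\<sigma>\<close> without
  listing their vertices.\<close>

lemma finite_selfmap_bij_subset:
  assumes "finite A" "A \<noteq> {}" "\<sigma> ` A \<subseteq> A"
  obtains J where "J \<subseteq> A" "J \<noteq> {}" "bij_betw \<sigma> J J"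
proof -
  let ?C = "{J. J \<subseteq> A \<and> J \<noteq> {} \<and> \<sigma> ` J \<subseteq> J}"
  have "finite ?C" "?C \<noteq> {}"
    using assms by auto
  then obtain J where J: "J \<in> ?C" and min: "\<And>J'. J' \<in> ?C \<Longrightarrow> J' \<subseteq> J \<Longrightarrow> J = J'"
    using finite_has_minimal[of ?C] by (metis (no_types, lifting))
  have "\<sigma> ` J \<in> ?C"
    using J by auto
  then have "\<sigma> ` J = J"
    using J min by auto
  moreover have "finite J"
    using J assms(1) finite_subset by auto
  ultimately have "bij_betw \<sigma> J J"
    by (simp add: bij_betw_def finite_surj_inj)
  with J that show thesis
    by blast
qed

text \<open>If \<open>N\<close> avoids \<open>I\<close>, it lives in a clique and can have only one
  edge. Otherwise some covered vertex of \<open>I\<close> works: if all of these had two covered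
  neighbours, walking from each to a neighbour other than its partner and on along \<open>N\<close>
  would stay in \<open>I\<close> and close an alternating cycle.\<close>

lemma split_unique_matching_pendant:
  assumes E: "E \<subseteq> [V]\<^bsup>2\<^esup>" and "finite V" and um: "unique_matching E N" and "N \<noteq> {}"
    and KI: "K \<union> I = V" "K \<inter> I = {}" "clique K E" "indep I E"
  shows "\<exists>v\<in>\<Union>N. card (neighbours E v \<inter> \<Union>N) \<le> 1"
proof (cases "I \<inter> \<Union>N = {}")
  case True
  have NE: "N \<subseteq> E" "pairwise disjnt N"
    using um by (simp_all add: unique_matching_def)
  have C4: "no_alternating_C4 E N"
    using unique_matching_no_alternating_C4 um NE E by blast
  from \<open>N \<noteq> {}\<close> obtain e where e: "e \<in> N"
    by blast
  then have "e \<in> [V]\<^bsup>2\<^esup>"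
    using NE E by blast
  then obtain a b where ab: "e = {a, b}" "a \<noteq> b"
    by (auto simp: nsets_def card_2_iff)
  \<comment> \<open>Two edges inside the clique would span an alternating 4-cycle.\<close>
  have "e' = e" if "e' \<in> N" for e'
  proof (rule ccontr)
    assume ne: "e' \<noteq> e"
    have "e' \<in> [V]\<^bsup>2\<^esup>"
      using that NE E by blast
    then obtain c d where cd: "e' = {c, d}" "c \<noteq> d"
      by (auto simp: nsets_def card_2_iff)
    have "disjnt e e'"
      using NE(2) e that ne by (auto simp: pairwise_def)
    moreover have "e \<subseteq> K" "e' \<subseteq> K"
      using e that True NE E KI by (auto simp: nsets_def)
    ultimately have "{a, c} \<in> E" "{b, d} \<in> E"
      using KI(3) ab cd by (auto simp: clique_def disjnt_def)
    then show False
      using no_alternating_C4D[OF C4, of a b c d] ab cd e that ne by auto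
  qed
  then have "\<Union>N = {a, b}"
    using e ab by blast
  moreover have "a \<notin> neighbours E a"
    using edgeD(3)[OF E] by (simp only: neighbours_def mem_Collect_eq) blast
  ultimately have "neighbours E a \<inter> \<Union>N \<subseteq> {b}" "a \<in> \<Union>N"
    by auto
  then have "card (neighbours E a \<inter> \<Union>N) \<le> 1"
    using card_mono[of "{b}"] by fastforce
  then show ?thesis
    using \<open>a \<in> \<Union>N\<close> by blast
next
  case False
  have NE: "N \<subseteq> E" "pairwise disjnt N"
    using um by (simp_all add: unique_matching_def)
  have C4: "no_alternating_C4 E N"
    using unique_matching_no_alternating_C4 um NE E by blast
  have partner_eq: "w = w'" if "{v, w} \<in> N" "{v, w'} \<in> N" for v w w'
  proof (rule ccontr)
    assume "w \<noteq> w'"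
    then have "{v, w} \<noteq> {v, w'}"
      by (auto simp: doubleton_eq_iff)
    then show False
      using pairwiseD[OF NE(2) that] by simp
  qed
  have "\<forall>v\<in>\<Union>N. \<exists>w. {v, w} \<in> N"
    using NE E by (auto elim!: nsets_2_memE dest!: subsetD)
  \<comment> \<open>\<open>p\<close> sends a covered vertex to its partner in
    \<open>N\<close>.\<close>
  then obtain p where p: "\<And>v. v \<in> \<Union>N \<Longrightarrow> {v, p v} \<in> N"
    by metis
  have p_K: "p i \<in> K" if "i \<in> I \<inter> \<Union>N" for i
  proof -
    have "{i, p i} \<in> E"
      using p that NE by blast
    then show ?thesis
      using edgeD[OF E, of i "p i"] KI that unfolding indep_def by blast
  qed
  have p_inj: "i = j" if "i \<in> \<Union>N" "j \<in> \<Union>N" "p i = p j" for i j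
    using partner_eq[of "p i" i j] p[OF that(1)] p[OF that(2)] that(3)
    by (simp add: insert_commute)
  show ?thesis
  proof (rule ccontr)
    assume contr: "\<not> ?thesis"
    \<comment> \<open>A second covered neighbour \<open>k\<close> of \<open>i\<close> lies in
      \<open>K\<close>; the witness is its partner \<open>p k\<close>, since
      \<open>p (p k) = k\<close>.\<close>
    have "\<exists>j. j \<in> I \<inter> \<Union>N \<and> j \<noteq> i \<and> {i, p j} \<in> E" if i: "i \<in> I \<inter> \<Union>N" for i
    proof -
      have "\<not> neighbours E i \<inter> \<Union>N \<subseteq> {p i}"
        using contr i card_mono[of "{p i}"] by fastforce
      then obtain k where k: "{i, k} \<in> E" "k \<in> \<Union>N" "k \<noteq> p i"
        by (auto simp: neighbours_def)
      have kK: "k \<in> K"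
        using edgeD[OF E k(1)] k(1) KI i unfolding indep_def by blast
      have kp: "{k, p k} \<in> N"
        using p k by blast
      have "p k \<in> \<Union>N"
        using kp by blast
      have pk: "p (p k) = k"
        using p[OF \<open>p k \<in> \<Union>N\<close>] kp partner_eq by (metis insert_commute)
      \<comment> \<open>If \<open>p k\<close> were in the clique, it would be adjacent to
        \<open>p i\<close>, and \<open>{i, k}\<close> with \<open>{p i, p k}\<close> would complete
        an alternating 4-cycle.\<close>
      have "p k \<in> I"
      proof (rule ccontr)
        assume "p k \<notin> I"
        then have "p k \<in> K"
          using edgeD(2)[OF E, of k "p k"] kp NE(1) KI(1) by blast
        moreover have "p i \<noteq> p k"
          using p_inj[of i k] i k kK KI by auto
        ultimately have "{p i, p k} \<in> E"
          using p_K[OF i] KI(3) by (auto simp: clique_def)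
        moreover have "{i, p i} \<noteq> {k, p k}"
          using i k kK KI(2) by (auto simp: doubleton_eq_iff)
        ultimately show False
          using no_alternating_C4D[OF C4, of i "p i" k "p k"] p i k kp by blast
      qed
      then show ?thesis
        using k pk \<open>p k \<in> \<Union>N\<close> by (intro exI[of _ "p k"]) auto
    qed
    \<comment> \<open>A set permuted by \<open>\<sigma>\<close> consists of alternating cycles \<open>i, p (\<sigma> i), \<sigma> i, p (\<sigma> (\<sigma> i)), \<dots>\<close>\<close>
    then obtain \<sigma> where \<sigma>: "\<And>i. i \<in> I \<inter> \<Union>N \<Longrightarrow> \<sigma> i \<in> I \<inter> \<Union>N \<and> \<sigma> i \<noteq> i \<and> {i, p (\<sigma> i)} \<in> E"
      by metis
    have "finite (I \<inter> \<Union>N)"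
      using assms(2) KI(1) by auto
    then obtain J where J: "J \<subseteq> I \<inter> \<Union>N" "J \<noteq> {}" "bij_betw \<sigma> J J"
      using finite_selfmap_bij_subset[of "I \<inter> \<Union>N" \<sigma>] False \<sigma> by blast
    have \<sigma>': "i \<in> \<Union>N" "\<sigma> i \<in> \<Union>N" "\<sigma> i \<noteq> i" if "i \<in> J" for i
      using \<sigma>[of i] that J(1) by blast+
    let ?A = "(\<lambda>i. {i, p i}) ` J" and ?B = "(\<lambda>i. {i, p (\<sigma> i)}) ` J"
    have \<sigma>J: "\<sigma> ` J = J" "inj_on \<sigma> J"
      using J by (auto simp: bij_betw_def)
    have "?B \<subseteq> N"
    proof (rule unique_matching_switch[OF um])
      show "?A \<subseteq> N"
        using p J(1) by blast
      show "?B \<subseteq> E"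
        using \<sigma> J(1) by blast
      have "\<Union>?B = J \<union> p ` \<sigma> ` J"
        by auto
      also have "\<dots> = \<Union>?A"
        unfolding \<sigma>J by auto
      finally show "\<Union>?B = \<Union>?A" .
      have IK: "i \<noteq> p (\<sigma> j)" if "i \<in> J" "j \<in> J" for i j
        using p_K[of "\<sigma> j"] \<sigma>[of j] that J KI(2) by blast
      have inj: "i = j" if "i \<in> J" "j \<in> J" "p (\<sigma> i) = p (\<sigma> j)" for i j
      proof -
        have "\<sigma> i = \<sigma> j"
          by (rule p_inj[OF \<sigma>'(2)[OF that(1)] \<sigma>'(2)[OF that(2)] that(3)])
        then show ?thesis
          using \<sigma>J(2) that by (simp add: inj_on_def)
      qed
      show "pairwise disjnt ?B"
      proof (rule pairwiseI)
        fix e e' assume "e \<in> ?B" "e' \<in> ?B" "e \<noteq> e'"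
        then obtain i j where ij: "i \<in> J" "j \<in> J" "i \<noteq> j"
          "e = {i, p (\<sigma> i)}" "e' = {j, p (\<sigma> j)}"
          by blast
        then show "disjnt e e'"
          using IK[OF ij(1,2)] IK[OF ij(2,1)] inj[OF ij(1,2)]
          by (auto simp: disjnt_def)
      qed
    qed
    moreover obtain i where i: "i \<in> J"
      using J(2) by blast
    ultimately have "{i, p (\<sigma> i)} \<in> N"
      by blast
    \<comment> \<open>Both are partners of \<open>i\<close> in \<open>N\<close>. Injectivity of
      \<open>p\<close> then makes \<open>i\<close> a fixed point of \<open>\<sigma>\<close>, which
      was excluded.\<close>
    then have "p (\<sigma> i) = p i"
      using partner_eq p[OF \<sigma>'(1)[OF i]] by blast
    then show False
      using p_inj \<sigma>'[OF i] by blast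
  qed
qed

section \<open>Cographs\<close>

lemma cograph_nsets: "cograph V E \<Longrightarrow> E \<subseteq> [V]\<^bsup>2\<^esup>"
proof (induction rule: cograph.induct)
  case (disjoint_union V E W F)
  then show ?case
    using nsets_mono[of V "V \<union> W" 2] nsets_mono[of W "V \<union> W" 2] by blast
next
  case (join V E W F)
  have "{{v, w} | v w. v \<in> V \<and> w \<in> W} \<subseteq> [V \<union> W]\<^bsup>2\<^esup>"
    using join.hyps by (auto simp: doubleton_nsets_iff)
  then show ?case
    using join.IH nsets_mono[of V "V \<union> W" 2] nsets_mono[of W "V \<union> W" 2] by blast
qed simp

text \<open>A covered b in \<open>W\<close> has its partner a in \<open>V\<close>, and a has no
  other covered neighbour. Indeed, let c be one, with partner d; the edge cd is not inside
  \<open>W\<close>. If d is in \<open>V\<close>, then ac and the cross edge bd close an alternating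
  4-cycle; otherwise c is in \<open>V\<close>, and the cross edges ad and bc do.\<close>

lemma join_matching_pendant:
  assumes E: "E \<subseteq> [V \<union> W]\<^bsup>2\<^esup>" and "V \<inter> W = {}"
    and cross: "\<And>v w. v \<in> V \<Longrightarrow> w \<in> W \<Longrightarrow> {v, w} \<in> E"
    and N: "N \<subseteq> E" "pairwise disjnt N" and C4: "no_alternating_C4 E N"
    and W: "W \<inter> \<Union>N \<noteq> {}" and noW: "\<And>e. e \<in> N \<Longrightarrow> \<not> e \<subseteq> W"
  shows "\<exists>v\<in>\<Union>N. card (neighbours E v \<inter> \<Union>N) \<le> 1"
proof -
  have edge: "\<exists>w. e = {v, w} \<and> v \<in> V \<union> W \<and> w \<in> V \<union> W \<and> v \<noteq> w" if "e \<in> N" "v \<in> e" for e v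
    using that N E by (meson nsets_2_memE subsetD)
  from W obtain b e where b: "b \<in> W" "b \<in> e" "e \<in> N"
    by blast
  then obtain a where a: "e = {b, a}" "a \<in> V"
    using edge[OF b(3,2)] noW[OF b(3)] by auto
  have "neighbours E a \<inter> \<Union>N \<subseteq> {b}"
  proof
    fix c assume c: "c \<in> neighbours E a \<inter> \<Union>N"
    then have ac: "{a, c} \<in> E" "a \<noteq> c"
      using edgeD(3)[OF E, of a c] by (simp_all add: neighbours_def)
    from c obtain e' d where d: "e' \<in> N" "e' = {c, d}" "c \<in> V \<union> W" "d \<in> V \<union> W"
      using edge by blast
    show "c \<in> {b}"
    proof (rule ccontr)
      assume "c \<notin> {b}"
      then have ne: "{a, b} \<noteq> {c, d}"
        using ac by (auto simp: doubleton_eq_iff)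
      have ab: "{a, b} \<in> N"
        using a b by (simp add: insert_commute)
      consider "d \<in> V" | "d \<in> W" "c \<in> V"
        using d noW[of e'] by auto
      then show False
      proof cases
        case 1
        then have "{b, d} \<in> E"
          using cross[of d b] b by (simp add: insert_commute)
        then show False
          using no_alternating_C4D[OF C4 ab, of c d] d ne ac by blast
      next
        case 2
        then have "{a, d} \<in> E" "{b, c} \<in> E"
          using cross[of c b] cross[of a d] a b by (simp_all add: insert_commute)
        then show False
          using no_alternating_C4D[OF C4 ab, of d c] d ne by (simp add: insert_commute)
      qed
    qed
  qed
  then have "card (neighbours E a \<inter> \<Union>N) \<le> 1"
    using card_mono[of "{b}"] by fastforce
  then show ?thesis
    using a b by blast
qed

lemma neighbours_disjoint_Un:
  assumes "\<Union>E \<inter> \<Union>F = {}" "N \<subseteq> E \<union> F" "v \<in> \<Union>E"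
  shows "neighbours (E \<union> F) v \<inter> \<Union>N = neighbours E v \<inter> \<Union>(N \<inter> E)"
  using assms unfolding neighbours_def by blast

lemma neighbours_join_Int:
  assumes "\<Union>F \<subseteq> W" "v \<notin> W" "U \<inter> W = {}"
  shows "neighbours (E \<union> F \<union> {{v, w} | v w. v \<in> V \<and> w \<in> W}) v \<inter> U = neighbours E v \<inter> U"
proof -
  have "{v, w} \<notin> F" if "w \<in> U" for w
    using assms by blast
  moreover have "{v, w} \<notin> {{v, w} | v w. v \<in> V \<and> w \<in> W}" if "w \<in> U" for w
    using assms that by (auto simp: doubleton_eq_iff)
  ultimately show ?thesis
    unfolding neighbours_def by blast
qed

lemma join_edges_commute:
  "E \<union> F \<union> {{v, w} | v w. v \<in> V \<and> w \<in> W} = F \<union> E \<union> {{w, v} | w v. w \<in> W \<and> v \<in> V}"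
  by (auto simp: insert_commute)

lemma no_alternating_C4_mono:
  "no_alternating_C4 E N \<Longrightarrow> E' \<subseteq> E \<Longrightarrow> N' \<subseteq> N \<Longrightarrow> no_alternating_C4 E' N'"
  unfolding no_alternating_C4_def by (meson subsetD)

text \<open>For cographs it suffices to exclude alternating 4-cycles, a condition inherited by the
  two parts of a union or join, so the induction runs directly on it.\<close>

lemma cograph_matching_pendant:
  assumes "cograph V E" "N \<subseteq> E" "pairwise disjnt N" "no_alternating_C4 E N" "N \<noteq> {}"
  shows "\<exists>v\<in>\<Union>N. card (neighbours E v \<inter> \<Union>N) \<le> 1"
  using assms
proof (induction arbitrary: N rule: cograph.induct)
  case (single v)
  then show ?case
    by simp
next
  case (disjoint_union V E W F)
  have EFU: "\<Union>E \<inter> \<Union>F = {}"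
    using Union_nsets_subset[OF cograph_nsets] disjoint_union.hyps by blast
  have sub: "pairwise disjnt (N \<inter> E)" "pairwise disjnt (N \<inter> F)"
    "no_alternating_C4 E (N \<inter> E)" "no_alternating_C4 F (N \<inter> F)"
    using pairwise_subset[OF disjoint_union.prems(2)]
      no_alternating_C4_mono[OF disjoint_union.prems(3)] by simp_all
  consider "N \<inter> E \<noteq> {}" | "N \<inter> F \<noteq> {}"
    using disjoint_union.prems by blast
  then show ?case
  proof cases
    case 1
    then obtain v where v: "v \<in> \<Union>(N \<inter> E)" "card (neighbours E v \<inter> \<Union>(N \<inter> E)) \<le> 1"
      using disjoint_union.IH(1)[OF Int_lower2 sub(1,3)] by blast
    have "neighbours (E \<union> F) v \<inter> \<Union>N = neighbours E v \<inter> \<Union>(N \<inter> E)"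
      using EFU disjoint_union.prems(1) v(1) by (intro neighbours_disjoint_Un) auto
    then show ?thesis
      using v by (intro bexI[of _ v]) auto
  next
    case 2
    then obtain v where v: "v \<in> \<Union>(N \<inter> F)" "card (neighbours F v \<inter> \<Union>(N \<inter> F)) \<le> 1"
      using disjoint_union.IH(2)[OF Int_lower2 sub(2,4)] by blast
    have "neighbours (F \<union> E) v \<inter> \<Union>N = neighbours F v \<inter> \<Union>(N \<inter> F)"
      using EFU disjoint_union.prems(1) v(1) by (intro neighbours_disjoint_Un) auto
    then have "neighbours (E \<union> F) v \<inter> \<Union>N = neighbours F v \<inter> \<Union>(N \<inter> F)"
      by (simp add: Un_commute)
    then show ?thesis
      using v by (intro bexI[of _ v]) auto
  qed
next
  case (join V E W F)
  let ?G = "E \<union> F \<union> {{v, w} | v w. v \<in> V \<and> w \<in> W}"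
  have EFU: "\<Union>E \<subseteq> V" "\<Union>F \<subseteq> W"
    by (rule Union_nsets_subset[OF cograph_nsets], fact)+
  have G: "?G \<subseteq> [V \<union> W]\<^bsup>2\<^esup>"
    using cograph_nsets[OF cograph.join[OF join.hyps]] .
  have cross: "{v, w} \<in> ?G" if "v \<in> V" "w \<in> W" for v w
    using that by blast
  have N2: "e \<in> [V \<union> W]\<^bsup>2\<^esup>" if "e \<in> N" for e
    using that by (rule subsetD[OF subset_trans[OF join.prems(1) G]])
  \<comment> \<open>If \<open>N\<close> misses a side, induction applies to the other one. If it
    meets a side without an edge inside it, \<open>join_matching_pendant\<close> applies. In the
    remaining case each side contains an edge of \<open>N\<close>, and cross edges link these two
    into an alternating 4-cycle.\<close>
  consider "W \<inter> \<Union>N = {}" | "V \<inter> \<Union>N = {}" | "W \<inter> \<Union>N \<noteq> {}" "\<And>e. e \<in> N \<Longrightarrow> \<not> e \<subseteq> W"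
    | "V \<inter> \<Union>N \<noteq> {}" "\<And>e. e \<in> N \<Longrightarrow> \<not> e \<subseteq> V"
    | e e' where "e \<in> N" "e \<subseteq> V" "e' \<in> N" "e' \<subseteq> W"
    by metis
  then show ?case
  proof cases
    case 1
    have "N \<subseteq> E"
    proof
      fix e assume e: "e \<in> N"
      then have "e \<inter> W = {}" "e \<noteq> {}" "e \<in> ?G"
        using 1 N2[OF e] join.prems(1) by (auto simp: nsets_def)
      then show "e \<in> E"
        using EFU by blast
    qed
    moreover have "no_alternating_C4 E N"
      using join.prems(3) by (rule no_alternating_C4_mono) auto
    ultimately obtain v where v: "v \<in> \<Union>N" "card (neighbours E v \<inter> \<Union>N) \<le> 1"
      using join.IH(1)[OF _ join.prems(2) _ join.prems(4)] by blast
    have "neighbours ?G v \<inter> \<Union>N = neighbours E v \<inter> \<Union>N"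
      by (rule neighbours_join_Int) (use v 1 EFU in auto)
    then show ?thesis
      using v by (intro bexI[of _ v]) auto
  next
    case 2
    have "N \<subseteq> F"
    proof
      fix e assume e: "e \<in> N"
      then have "e \<inter> V = {}" "e \<noteq> {}" "e \<in> ?G"
        using 2 N2[OF e] join.prems(1) by (auto simp: nsets_def)
      then show "e \<in> F"
        using EFU by blast
    qed
    moreover have "no_alternating_C4 F N"
      using join.prems(3) by (rule no_alternating_C4_mono) auto
    ultimately obtain v where v: "v \<in> \<Union>N" "card (neighbours F v \<inter> \<Union>N) \<le> 1"
      using join.IH(2)[OF _ join.prems(2) _ join.prems(4)] by blast
    have "neighbours ?G v \<inter> \<Union>N = neighbours F v \<inter> \<Union>N"
      unfolding join_edges_commute[of E F]
      by (rule neighbours_join_Int) (use v 2 EFU in auto)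
    then show ?thesis
      using v by (intro bexI[of _ v]) auto
  next
    case 3
    show ?thesis
      by (rule join_matching_pendant[OF G join.hyps(3) cross join.prems(1-3) 3])
  next
    case 4
    have "?G \<subseteq> [W \<union> V]\<^bsup>2\<^esup>" "W \<inter> V = {}"
      using G join.hyps(3) by (simp_all add: Un_commute Int_commute)
    moreover have "{w, v} \<in> ?G" if "w \<in> W" "v \<in> V" for v w
      using cross[OF that(2,1)] by (simp add: insert_commute)
    ultimately show ?thesis
      using join.prems(1-3) 4 by (rule join_matching_pendant)
  next
    case 5
    obtain a b where ab: "e = {a, b}"
      using N2[OF \<open>e \<in> N\<close>] by (auto simp: nsets_def card_2_iff)
    obtain c d where cd: "e' = {c, d}"
      using N2[OF \<open>e' \<in> N\<close>] by (auto simp: nsets_def card_2_iff)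
    have "a \<in> V" "b \<in> V" "c \<in> W" "d \<in> W"
      using 5 ab cd by simp_all
    then have "{a, c} \<in> ?G" "{b, d} \<in> ?G"
      using cross by simp_all
    moreover have "{a, b} \<noteq> {c, d}"
      using \<open>a \<in> V\<close> \<open>c \<in> W\<close> \<open>d \<in> W\<close> join.hyps(3) by (auto simp: doubleton_eq_iff)
    ultimately show ?thesis
      using no_alternating_C4D[OF join.prems(3) 5(1)[unfolded ab] 5(3)[unfolded cd]] by blast
  qed
qed

section \<open>The lower bound\<close>

text \<open>\<open>M\<close> covers all neighbours of \<open>v\<close>: at most one is covered by
  \<open>M - S\<close>, and \<open>S\<close> covers at most \<open>2 * card S\<close>
  vertices.\<close>

lemma degree_le_forcing_set:
  assumes G: "simple_graph V E" and M: "perfect_matching V E M" and S: "forcing_set V E M S"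
    and v: "card (neighbours E v \<inter> \<Union>(M - S)) \<le> 1"
  shows "degree E v \<le> 1 + 2 * card S"
proof -
  have E: "E \<subseteq> [V]\<^bsup>2\<^esup>"
    using G by (simp add: simple_graph_def)
  have "S \<subseteq> E"
    using S M by (auto simp: forcing_set_def perfect_matching_def)
  then have S2: "S \<subseteq> [V]\<^bsup>2\<^esup>" "finite S"
    using E finite_edges[OF G] by (simp_all add: finite_subset)
  have fin: "finite (\<Union>S)"
    using Union_nsets_subset[OF S2(1)] G finite_subset by (auto simp: simple_graph_def)
  have "neighbours E v \<subseteq> V"
    using edgeD(2)[OF E] unfolding neighbours_def by blast
  then have "neighbours E v = (neighbours E v \<inter> \<Union>(M - S)) \<union> (neighbours E v \<inter> \<Union>S)"
    using perfect_matching_Union[OF E M] by blast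
  then have "card (neighbours E v) \<le> card (neighbours E v \<inter> \<Union>(M - S)) + card (neighbours E v \<inter> \<Union>S)"
    using card_Un_le[of "neighbours E v \<inter> \<Union>(M - S)" "neighbours E v \<inter> \<Union>S"] by simp
  also have "card (neighbours E v \<inter> \<Union>S) \<le> card (\<Union>S)"
    using fin by (intro card_mono) auto
  also have "\<dots> \<le> (\<Sum>e\<in>S. card e)"
    by (rule card_Union_le_sum_card)
  also have "\<dots> = (\<Sum>e\<in>S. 2)"
    using S2 by (intro sum.cong) (auto simp: nsets_def)
  finally show ?thesis
    using v degree_eq_card_neighbours[OF E] by simp
qed

lemma min_degree_le_forcing_set:
  assumes G: "simple_graph V E" "split_graph V E \<or> cograph V E"
    and M: "perfect_matching V E M" and S: "forcing_set V E M S"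
  shows "min_degree V E \<le> 1 + 2 * card S"
proof -
  have V: "finite V" "V \<noteq> {}" and E: "E \<subseteq> [V]\<^bsup>2\<^esup>"
    using G by (auto simp: simple_graph_def)
  have um: "unique_matching E (M - S)"
    by (rule forcing_set_unique_matching[OF E M S])
  have "\<exists>v\<in>V. card (neighbours E v \<inter> \<Union>(M - S)) \<le> 1"
  \<comment> \<open>If \<open>S\<close> is all of \<open>M\<close>, no vertex is left uncovered and
    any vertex will do.\<close>
  proof (cases "M - S = {}")
    case True
    then show ?thesis
      unfolding True using V by auto
  next
    case False
    have "\<exists>v\<in>\<Union>(M - S). card (neighbours E v \<inter> \<Union>(M - S)) \<le> 1"
      using G(2)
    proof
      assume "split_graph V E"
      then show ?thesis
        unfolding split_graph_def using split_unique_matching_pendant[OF E V(1) um False] by metis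
    next
      assume "cograph V E"
      moreover have "M - S \<subseteq> E" "pairwise disjnt (M - S)"
        using um by (auto simp: unique_matching_def)
      moreover have "no_alternating_C4 E (M - S)"
        using unique_matching_no_alternating_C4[OF um] calculation(2) E by blast
      ultimately show ?thesis
        using cograph_matching_pendant False by blast
    qed
    moreover have "\<Union>(M - S) \<subseteq> V"
      using perfect_matching_Union[OF E M] by blast
    ultimately show ?thesis
      by blast
  qed
  then obtain v where "v \<in> V" "degree E v \<le> 1 + 2 * card S"
    using degree_le_forcing_set[OF G(1) M S] by blast
  moreover have "min_degree V E \<le> degree E v"
    using \<open>v \<in> V\<close> V by (simp add: min_degree_def)
  ultimately show ?thesis
    by linarith
qed

section \<open>The forcing number as an attained minimum\<close>

lemma perfect_matching_self_forcing:
  assumes "E \<subseteq> [V]\<^bsup>2\<^esup>" "perfect_matching V E M"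
  shows "forcing_set V E M M"
  using perfect_matching_subset_eq[OF assms] by (simp add: forcing_set_def)

lemma finite_forcing_set_cards:
  assumes "simple_graph V E" "perfect_matching V E M"
  shows "finite {card S | S. forcing_set V E M S}"
proof -
  have "finite M"
    using assms finite_edges by (metis perfect_matching_def finite_subset)
  then have "finite {S. forcing_set V E M S}"
    by (rule finite_subset[rotated, OF finite_Pow_iff[THEN iffD2]]) (auto simp: forcing_set_def)
  then show ?thesis
    by simp
qed

lemma finite_matching_forcing_numbers:
  assumes "simple_graph V E"
  shows "finite {matching_forcing_number V E M | M. perfect_matching V E M}"
proof -
  have "finite {M. perfect_matching V E M}"
    by (rule finite_subset[of _ "Pow E"])
      (use finite_edges[OF assms] in \<open>auto simp: perfect_matching_def\<close>)
  then show ?thesis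
    by simp
qed

text \<open>Both \<open>Min\<close> operators range over finite nonempty sets: the outer one by the
  existence of a perfect matching, the inner one because \<open>M\<close> forces itself.\<close>

lemma forcing_number_attained:
  assumes "simple_graph V E" "has_perfect_matching V E"
  obtains M S where "perfect_matching V E M" "forcing_set V E M S" "forcing_number V E = card S"
proof -
  have "forcing_number V E \<in> {matching_forcing_number V E M | M. perfect_matching V E M}"
    unfolding forcing_number_def
    by (rule Min_in[OF finite_matching_forcing_numbers[OF assms(1)]])
      (use assms(2) in \<open>auto simp: has_perfect_matching_def\<close>)
  then obtain M where M: "perfect_matching V E M"
    "forcing_number V E = matching_forcing_number V E M"
    by blast
  have "forcing_set V E M M"
    using perfect_matching_self_forcing M(1) assms(1) by (auto simp: simple_graph_def)
  then have "matching_forcing_number V E M \<in> {card S | S. forcing_set V E M S}"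
    unfolding matching_forcing_number_def
    by (intro Min_in finite_forcing_set_cards[OF assms(1) M(1)]) auto
  with M that show thesis
    by auto
qed

lemma forcing_number_le:
  assumes "simple_graph V E" "perfect_matching V E M" "forcing_set V E M S"
  shows "forcing_number V E \<le> card S"
proof -
  have "forcing_number V E \<le> matching_forcing_number V E M"
    unfolding forcing_number_def
    using assms by (intro Min_le finite_matching_forcing_numbers) auto
  also have "\<dots> \<le> card S"
    unfolding matching_forcing_number_def
    using assms by (intro Min_le finite_forcing_set_cards) auto
  finally show ?thesis .
qed

lemma min_degree_le_forcing_number:
  assumes "simple_graph V E" "split_graph V E \<or> cograph V E" "has_perfect_matching V E"
  shows "min_degree V E \<le> 1 + 2 * forcing_number V E"
  using forcing_number_attained[OF assms(1,3)] min_degree_le_forcing_set[OF assms(1,2)] by metis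

section \<open>Threshold graphs attaining the bound\<close>

text \<open>The vertices are added in increasing order, those in \<open>D\<close> as dominating and
  the others as isolated vertices. \<open>D\<close> stays arbitrary because every choice gives a
  split graph and, for \<open>p > 0\<close>, a cograph.\<close>

definition threshold_edges :: "nat set \<Rightarrow> nat \<Rightarrow> nat set set" where
  "threshold_edges D p = {{a, b} | a b. a < b \<and> b < p \<and> b \<in> D}"

lemma threshold_edges_iff:
  "a < b \<Longrightarrow> {a, b} \<in> threshold_edges D p \<longleftrightarrow> b < p \<and> b \<in> D"
  by (auto simp: threshold_edges_def doubleton_eq_iff)

lemma threshold_edges_nsets: "threshold_edges D p \<subseteq> [{..<p}]\<^bsup>2\<^esup>"
  by (auto simp: threshold_edges_def doubleton_nsets_iff)

lemma threshold_simple_graph: "p > 0 \<Longrightarrow> simple_graph {..<p} (threshold_edges D p)"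
  using threshold_edges_nsets by (auto simp: simple_graph_def)

text \<open>Adjacency depends only on whether the larger vertex is in \<open>D\<close>, so
  \<open>D\<close> gives the clique and its complement the independent set.\<close>

lemma threshold_split_graph: "split_graph {..<p} (threshold_edges D p)"
proof -
  have "{v, w} \<in> threshold_edges D p" if "v \<in> {..<p} \<inter> D" "w \<in> {..<p} \<inter> D" "v \<noteq> w" for v w
    using that threshold_edges_iff[of v w D p] threshold_edges_iff[of w v D p]
    by (cases v w rule: linorder_cases) (simp_all add: insert_commute[of w v])
  then have "clique ({..<p} \<inter> D) (threshold_edges D p)"
    by (auto simp: clique_def)
  moreover have "indep ({..<p} - D) (threshold_edges D p)"
    by (auto simp: indep_def threshold_edges_def doubleton_eq_iff)
  ultimately show ?thesis
    unfolding split_graph_def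
    by (intro exI[of _ "{..<p} \<inter> D"] exI[of _ "{..<p} - D"]) auto
qed

text \<open>Adding a dominating vertex is a join with a single vertex, adding an isolated one a
  disjoint union.\<close>

lemma threshold_cograph: "p > 0 \<Longrightarrow> cograph {..<p} (threshold_edges D p)"
proof (induction p rule: nat_induct_non_zero)
  case 1
  have "{..<1} = {0::nat}" "threshold_edges D 1 = {}"
    by (auto simp: threshold_edges_def)
  then show ?case
    by (metis cograph.single)
next
  case (Suc p)
  have V: "{..<Suc p} = {..<p} \<union> {p}" "{..<p} \<inter> {p} = {}"
    by auto
  show ?case
  proof (cases "p \<in> D")
    case True
    then have "threshold_edges D (Suc p) =
        threshold_edges D p \<union> {} \<union> {{v, w} | v w. v \<in> {..<p} \<and> w \<in> {p}}"
      by (auto simp: threshold_edges_def less_Suc_eq)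
    then show ?thesis
      using cograph.join[OF Suc.IH cograph.single V(2)] V(1) by simp
  next
    case False
    then have "threshold_edges D (Suc p) = threshold_edges D p \<union> {}"
      by (auto simp: threshold_edges_def less_Suc_eq)
    then show ?thesis
      using cograph.disjoint_union[OF Suc.IH cograph.single V(2)] V(1) by simp
  qed
qed

abbreviation consecutive_pairs :: "nat set \<Rightarrow> nat set set" where
  "consecutive_pairs J \<equiv> (\<lambda>j. {2 * j, Suc (2 * j)}) ` J"

text \<open>Below \<open>2 * m\<close> isolated and dominating additions alternate; from there on
  all are dominating. The top \<open>n - m\<close> pairs bound the forcing number from above, and
  the minimum degree, through the general inequality, bounds it from below.\<close>

lemma tight_threshold_graph:
  fixes n m :: nat
  assumes m: "0 < m" "m \<le> n"
  defines "E \<equiv> threshold_edges ({b. odd b} \<union> {2 * m..}) (2 * n)"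
  shows "has_perfect_matching {..<2 * n} E"
    and "min_degree {..<2 * n} E = 2 * (n - m) + 1"
    and "forcing_number {..<2 * n} E = n - m"
proof -
  have G: "simple_graph {..<2 * n} E" and S: "split_graph {..<2 * n} E"
    unfolding E_def using m by (auto intro!: threshold_simple_graph threshold_split_graph)
  have E: "E \<subseteq> [{..<2 * n}]\<^bsup>2\<^esup>"
    unfolding E_def by (rule threshold_edges_nsets)
  have E_iff: "{a, b} \<in> E \<longleftrightarrow> b < 2 * n \<and> (odd b \<or> 2 * m \<le> b)" if "a < b" for a b
    using threshold_edges_iff[OF that] by (auto simp: E_def)
  let ?M = "consecutive_pairs {..<n}" and ?S = "consecutive_pairs {m..<n}"
  have pm: "perfect_matching {..<2 * n} E ?M"
  proof (rule perfect_matchingI)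
    show "?M \<subseteq> E"
      using E_iff by auto
    show "pairwise disjnt ?M"
      by (auto simp: pairwise_def disjnt_def) presburger+
    show "{..<2 * n} \<subseteq> \<Union>?M"
    proof
      fix v assume "v \<in> {..<2 * n}"
      then have "v div 2 \<in> {..<n}" "v \<in> {2 * (v div 2), Suc (2 * (v div 2))}"
        by auto
      then show "v \<in> \<Union>?M"
        by blast
    qed
  qed
  then show hpm: "has_perfect_matching {..<2 * n} E"
    by (auto simp: has_perfect_matching_def)
  have fs: "forcing_set {..<2 * n} E ?M ?S"
    unfolding forcing_set_def
  proof (intro conjI allI impI)
    fix M' assume "perfect_matching {..<2 * n} E M' \<and> ?S \<subseteq> M'"
    then have M': "perfect_matching {..<2 * n} E M'" and SM': "?S \<subseteq> M'"
      by auto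
    \<comment> \<open>The pairs are recovered from the top down, hence the induction on
      \<open>n - j\<close>.\<close>
    have "{2 * j, Suc (2 * j)} \<in> M'" if "j < n" for j
      using that
    proof (induction "n - j" arbitrary: j rule: less_induct)
      case less
      show ?case
      proof (cases "m \<le> j")
        case True
        then show ?thesis
          using SM' less.prems by auto
      next
        case False
        from M' less.prems obtain e where e: "e \<in> M'" "2 * j \<in> e"
          unfolding perfect_matching_def by (metis lessThan_iff mult_less_cancel1 zero_less_numeral)
        then have "e \<in> [{..<2 * n}]\<^bsup>2\<^esup>" "e \<in> E"
          using M' E by (auto simp: perfect_matching_def)
        then obtain b where b: "e = {2 * j, b}" "2 * j \<noteq> b" "b < 2 * n" "{2 * j, b} \<in> E"
          using e(2) by (metis lessThan_iff nsets_2_memE)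
        \<comment> \<open>For \<open>j < m\<close> the vertex \<open>2 * j\<close> was added as
          isolated, so its partner comes later.\<close>
        have "\<not> b < 2 * j"
          using b(4) E_iff[of b "2 * j"] False by (auto simp: insert_commute)
        then have "j \<le> b div 2"
          using b(2) by linarith
        \<comment> \<open>Vertices of higher pairs are already matched within their pairs.\<close>
        have "\<not> j < b div 2"
        proof
          assume j: "j < b div 2"
          then have "{2 * (b div 2), Suc (2 * (b div 2))} \<in> M'"
            using less.hyps[of "b div 2"] b(3) less.prems by auto
          moreover have "b \<in> {2 * (b div 2), Suc (2 * (b div 2))}"
            by auto
          ultimately have "e = {2 * (b div 2), Suc (2 * (b div 2))}"
            using perfect_matching_edge_eq[OF M', of b e] e b by blast
          then show False
            using e(2) j by auto
        qed
        with \<open>j \<le> b div 2\<close> b(2) have "b = Suc (2 * j)"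
          by linarith
        then show ?thesis
          using e b by simp
      qed
    qed
    then have "?M \<subseteq> M'"
      by auto
    then show "M' = ?M"
      by (rule perfect_matching_subset_eq[OF E pm M'])
  qed auto
  have "card ?S = n - m"
    by (subst card_image) (auto simp: inj_on_def doubleton_eq_iff)
  then have upper: "forcing_number {..<2 * n} E \<le> n - m"
    using forcing_number_le[OF G pm fs] by simp
  \<comment> \<open>This is the last vertex added as isolated; its neighbours are exactly the
    \<open>2 * (n - m) + 1\<close> later vertices.\<close>
  let ?c = "2 * m - 2"
  have "neighbours E ?c = {2 * m - 1..<2 * n}"
  proof (rule set_eqI)
    fix w
    show "w \<in> neighbours E ?c \<longleftrightarrow> w \<in> {2 * m - 1..<2 * n}"
    proof (cases w ?c rule: linorder_cases)
      case less
      then show ?thesis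
        using E_iff[OF less] m by (auto simp: neighbours_def insert_commute)
    next
      case equal
      then show ?thesis
        using m edgeD(3)[OF E, of ?c w] by (auto simp: neighbours_def simp del: insert_absorb2)
    next
      case greater
      then have "odd w \<or> 2 * m \<le> w"
        using m by presburger
      then show ?thesis
        using E_iff[OF greater] greater m by (auto simp: neighbours_def)
    qed
  qed
  then have deg_c: "degree E ?c = 2 * (n - m) + 1"
    using m by (simp add: degree_eq_card_neighbours[OF E])
  \<comment> \<open>Vertices up to \<open>?c\<close> are adjacent to everything after
    \<open>?c\<close>; those after \<open>?c\<close> are dominating, as are all their successors, so
    they are adjacent to all other vertices.\<close>
  have deg_ge: "2 * (n - m) + 1 \<le> degree E v" if v: "v < 2 * n" for v
  proof -
    have fin: "finite (neighbours E v)"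
      by (rule finite_subset[of _ "{..<2 * n}"]) (use E in \<open>auto simp: neighbours_def nsets_def\<close>)
    show ?thesis
    proof (cases "v \<le> ?c")
      case True
      have "{2 * m - 1..<2 * n} \<subseteq> neighbours E v"
      proof
        fix w assume w: "w \<in> {2 * m - 1..<2 * n}"
        then have "v < w" "odd w \<or> 2 * m \<le> w"
          using True m by (simp_all, presburger+)
        then show "w \<in> neighbours E v"
          using E_iff w by (auto simp: neighbours_def)
      qed
      from card_mono[OF fin this] show ?thesis
        using m by (simp add: degree_eq_card_neighbours[OF E])
    next
      case False
      then have v': "odd v \<or> 2 * m \<le> v"
        using m by presburger
      have "{..<2 * n} - {v} \<subseteq> neighbours E v"
      proof
        fix w assume w: "w \<in> {..<2 * n} - {v}"
        show "w \<in> neighbours E v"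
        proof (cases "w < v")
          case True
          then show ?thesis
            using E_iff[OF True] v v' by (auto simp: neighbours_def insert_commute)
        next
          case ge: False
          then show ?thesis
            using E_iff[of v w] w False by (auto simp: neighbours_def)
        qed
      qed
      from card_mono[OF fin this] show ?thesis
        using v m by (simp add: degree_eq_card_neighbours[OF E])
    qed
  qed
  show md: "min_degree {..<2 * n} E = 2 * (n - m) + 1"
    unfolding min_degree_def
  proof (rule Min_eqI)
    show "2 * (n - m) + 1 \<in> degree E ` {..<2 * n}"
      using m by (intro image_eqI[where x = ?c]) (simp_all only: deg_c, auto)
  qed (use deg_ge in auto)
  show "forcing_number {..<2 * n} E = n - m"
    using upper min_degree_le_forcing_number[OF G disjI1[OF S] hpm] md by linarith
qed

theorem theorem2p8:
  shows "(\<forall>(V :: 'a set) (E :: 'a set set).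
            simple_graph V E \<and> (split_graph V E \<or> cograph V E) \<and> has_perfect_matching V E \<longrightarrow>
            real (forcing_number V E) \<ge> (real (min_degree V E) - 1) / 2) \<and>
         (\<forall>n k :: nat. n \<ge> 1 \<and> k \<le> n - 1 \<longrightarrow>
            (\<exists>(V :: nat set) (E :: nat set set).
               simple_graph V E \<and> split_graph V E \<and> has_perfect_matching V E \<and>
               card V = 2 * n \<and> min_degree V E = 2 * k + 1 \<and>
               real (forcing_number V E) = (real (min_degree V E) - 1) / 2) \<and>
            (\<exists>(V :: nat set) (E :: nat set set).
               simple_graph V E \<and> cograph V E \<and> has_perfect_matching V E \<and>
               card V = 2 * n \<and> min_degree V E = 2 * k + 1 \<and>
               real (forcing_number V E) = (real (min_degree V E) - 1) / 2))"
proof (rule conjI)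
  show "\<forall>(V :: 'a set) (E :: 'a set set).
            simple_graph V E \<and> (split_graph V E \<or> cograph V E) \<and> has_perfect_matching V E \<longrightarrow>
            real (forcing_number V E) \<ge> (real (min_degree V E) - 1) / 2"
  proof (intro allI impI)
    fix V :: "'a set" and E :: "'a set set"
    assume "simple_graph V E \<and> (split_graph V E \<or> cograph V E) \<and> has_perfect_matching V E"
    then have "min_degree V E \<le> 1 + 2 * forcing_number V E"
      by (intro min_degree_le_forcing_number) auto
    then show "real (forcing_number V E) \<ge> (real (min_degree V E) - 1) / 2"
      by simp
  qed
next
  \<comment> \<open>One graph, both split and a cograph, serves as witness for both existence
    claims.\<close>
  have tight: "\<exists>(V :: nat set) (E :: nat set set).
      simple_graph V E \<and> split_graph V E \<and> cograph V E \<and> has_perfect_matching V E \<and>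
      card V = 2 * n \<and> min_degree V E = 2 * k + 1 \<and>
      real (forcing_number V E) = (real (min_degree V E) - 1) / 2"
    if "n \<ge> 1 \<and> k \<le> n - 1" for n k :: nat
  proof -
    \<comment> \<open>The top \<open>k\<close> pairs are to form the forcing set;
      \<open>k \<le> n - 1\<close> leaves at least one pair below them.\<close>
    define m where "m = n - k"
    have m: "0 < m" "m \<le> n" "n - m = k" "0 < 2 * n"
      using that by (auto simp: m_def)
    let ?E = "threshold_edges ({b. odd b} \<union> {2 * m..}) (2 * n)"
    have "simple_graph {..<2 * n} ?E" "split_graph {..<2 * n} ?E" "cograph {..<2 * n} ?E"
      using m(4) threshold_simple_graph threshold_split_graph threshold_cograph by blast+
    moreover have "has_perfect_matching {..<2 * n} ?E" "min_degree {..<2 * n} ?E = 2 * k + 1"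
      "real (forcing_number {..<2 * n} ?E) = (real (min_degree {..<2 * n} ?E) - 1) / 2"
      using tight_threshold_graph[OF m(1,2)] m(3) by simp_all
    ultimately show ?thesis
      by (metis card_lessThan)
  qed
  then show "\<forall>n k :: nat. n \<ge> 1 \<and> k \<le> n - 1 \<longrightarrow>
            (\<exists>(V :: nat set) (E :: nat set set).
               simple_graph V E \<and> split_graph V E \<and> has_perfect_matching V E \<and>
               card V = 2 * n \<and> min_degree V E = 2 * k + 1 \<and>
               real (forcing_number V E) = (real (min_degree V E) - 1) / 2) \<and>
            (\<exists>(V :: nat set) (E :: nat set set).
               simple_graph V E \<and> cograph V E \<and> has_perfect_matching V E \<and>
               card V = 2 * n \<and> min_degree V E = 2 * k + 1 \<and>
               real (forcing_number V E) = (real (min_degree V E) - 1) / 2)"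
    by blast
qed

end
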